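(* Let $k$ be a positive integer, let $G$ be a finite graph and let $X,Y\subseteq V(G)$. Then at least one of the following holds: (1) there exist $k$ pairwise non-adjacent $X$-$Y$-paths in $G$; (2) there exists a set of fewer than $2^{\chi_s'(G)}k$ vertices of $G$ which separates $X$ and $Y$.
   Context: An $X$-$Y$-path is a path with one endpoint in $X$ and the other endpoint in $Y$; a single vertex of $X\cap Y$ counts as an $X$-$Y$-path (of length $0$). A set $Z\subseteq V(G)$ separates $X$ and $Y$ if $Z$ intersects every $X$-$Y$-path. Paths are called pairwise non-adjacent if they are pairwise vertex-disjoint and there is no edge of $G$ joining a vertex of one of them to a vertex of another (i.e. their pairwise distance in $G$ is at least $2$). An induced matching of $G$ is a set $M\subseteq E(G)$ such that any two distinct edges of $M$ share no vertex and no edge of $G$ joins an endpoint of one to an endpoint of the other. A strong edge colouring of $G$ is a partition of $E(G)$ into induced matchings, and the strong chromatic index $\chi_s'(G)$ is the minimum number of parts in a strong edge colouring of $G$. *)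

theory Defs
  imports
    "HOL-Library.Disjoint_Sets"
    "Graph_Theory.Digraph"
    "Graph_Theory.Vertex_Walk"
begin

text \<open>
  A finite simple undirected graph is an instance of the locale \<open>graph\<close>: a finite, symmetric,
  loop-free digraph without parallel arcs. Its undirected edges are the two-element sets of
  vertices that are joined by a pair of opposite arcs.
\<close>

definition uedges :: "('a, 'b) pre_digraph \<Rightarrow> 'a set set" where
  "uedges G = {{u, v} | u v. u \<rightarrow>\<^bsub>G\<^esub> v}"

text \<open>
  A path is a non-empty list of distinct vertices, consecutive ones being adjacent. A list and its
  reversal describe the same undirected path, hence the two cases below.
\<close>

definition XY_path :: "('a, 'b) pre_digraph \<Rightarrow> 'a set \<Rightarrow> 'a set \<Rightarrow> 'a list \<Rightarrow> bool" where
  "XY_path G X Y p \<longleftrightarrow>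
     vpath p G \<and> (hd p \<in> X \<and> last p \<in> Y \<or> hd p \<in> Y \<and> last p \<in> X)"

definition separates :: "('a, 'b) pre_digraph \<Rightarrow> 'a set \<Rightarrow> 'a set \<Rightarrow> 'a set \<Rightarrow> bool" where
  "separates G Z X Y \<longleftrightarrow> Z \<subseteq> verts G \<and> (\<forall>p. XY_path G X Y p \<longrightarrow> set p \<inter> Z \<noteq> {})"

definition nonadjacent :: "('a, 'b) pre_digraph \<Rightarrow> 'a list \<Rightarrow> 'a list \<Rightarrow> bool" where
  "nonadjacent G p q \<longleftrightarrow>
     set p \<inter> set q = {} \<and> (\<forall>u \<in> set p. \<forall>v \<in> set q. {u, v} \<notin> uedges G)"

definition induced_matching :: "('a, 'b) pre_digraph \<Rightarrow> 'a set set \<Rightarrow> bool" where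
  "induced_matching G M \<longleftrightarrow>
     M \<subseteq> uedges G \<and>
     (\<forall>e \<in> M. \<forall>f \<in> M. e \<noteq> f \<longrightarrow>
        e \<inter> f = {} \<and> (\<forall>u \<in> e. \<forall>v \<in> f. {u, v} \<notin> uedges G))"

definition strong_edge_colouring :: "('a, 'b) pre_digraph \<Rightarrow> 'a set set set \<Rightarrow> bool" where
  "strong_edge_colouring G \<M> \<longleftrightarrow>
     partition_on (uedges G) \<M> \<and> (\<forall>M \<in> \<M>. induced_matching G M)"

definition strong_chromatic_index :: "('a, 'b) pre_digraph \<Rightarrow> nat" where
  "strong_chromatic_index G = (LEAST n. \<exists>\<M>. strong_edge_colouring G \<M> \<and> card \<M> = n)"

end

theory Submission
  imports Defs
begin

text \<open>
  Menger's theorem provides \<open>2\<^sup>s k\<close> disjoint paths, where \<open>s\<close> is the strong chromatic index, unless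
  there is a small separator. The colour classes are then treated one at a time: for the next class
  \<open>M\<close>, take the graph formed by the current paths, each chosen shortest within its vertex set, together
  with the edges of \<open>M\<close>, and contract \<open>M\<close>. At least half as many disjoint paths survive the
  contraction, and no edge of \<open>M\<close> joins two of them. Since \<open>M\<close> is induced, no edge of an earlier colour
  joins two of them either.
\<close>

section \<open>Walks between vertex sets\<close>

text \<open>Walks rather than paths: vertices may repeat, so walks can be spliced and lifted without
  checking distinctness. Direction matters, and a single vertex of \<open>A \<inter> B\<close>
  counts.\<close>

definition linking :: "'a rel \<Rightarrow> 'a set \<Rightarrow> 'a set \<Rightarrow> 'a list \<Rightarrow> bool" where
  "linking E A B p \<longleftrightarrow>
     p \<noteq> [] \<and> successively (\<lambda>u v. (u, v) \<in> E) p \<and> hd p \<in> A \<and> last p \<in> B"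

text \<open>Minimality is only among walks inside the vertex set of \<open>q\<close>, so passing to
  a tight walk never leaves the old vertex set.\<close>

definition tight_linking :: "'a rel \<Rightarrow> 'a set \<Rightarrow> 'a set \<Rightarrow> 'a list \<Rightarrow> bool" where
  "tight_linking E A B q \<longleftrightarrow>
     linking E A B q \<and> (\<forall>p. linking E A B p \<longrightarrow> set p \<subseteq> set q \<longrightarrow> length q \<le> length p)"

text \<open>Interpolates between disjointness (\<open>C\<close> empty) and non-adjacency
  (\<open>C\<close> all arcs) while colours are added.\<close>

definition apart :: "'a rel \<Rightarrow> 'a list \<Rightarrow> 'a list \<Rightarrow> bool" where
  "apart C p q \<longleftrightarrow> set p \<inter> set q = {} \<and> (\<forall>u \<in> set p. \<forall>v \<in> set q. (u, v) \<notin> C)"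

lemma linking_mono:
  assumes "linking E A B p" "E \<subseteq> E'" "A \<subseteq> A'" "B \<subseteq> B'"
  shows "linking E' A' B' p"
  using assms unfolding linking_def by (auto elim!: successively_mono)

lemma linking_append_Cons:
  assumes "linking E A B (xs @ w # ys)" "linking E A' B' (xs' @ w # ys')"
  shows "linking E A B' (xs @ w # ys')"
  using assms unfolding linking_def
  by (auto simp: successively_append_iff hd_append split: if_splits)

lemma linking_verts:
  assumes "linking E A B p" "E \<subseteq> V \<times> V" "A \<subseteq> V"
  shows "set p \<subseteq> V"
proof
  fix v assume "v \<in> set p"
  then obtain xs ys where p: "p = xs @ v # ys" by (meson split_list)
  show "v \<in> V"
    using assms unfolding linking_def p
    by (cases xs rule: rev_cases) (auto simp: successively_append_iff)
qed

section \<open>Walks that are shortest within their own vertex set\<close>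

lemma tight_linking_exists:
  assumes "linking E A B p"
  obtains q where "tight_linking E A B q" "set q \<subseteq> set p"
proof -
  let ?P = "\<lambda>q. linking E A B q \<and> set q \<subseteq> set p"
  define q where "q = arg_min length ?P"
  have q: "?P q" and "\<And>r. ?P r \<Longrightarrow> length q \<le> length r"
    using arg_min_nat_lemma[of ?P p length] assms unfolding q_def by auto
  then show thesis by (intro that[of q]) (auto simp: tight_linking_def)
qed

text \<open>Shrinking vertex sets preserves \<open>apart\<close>. The number of walks survives
  because non-empty disjoint walks cannot become equal.\<close>

lemma tight_linking_family:
  assumes "\<forall>q \<in> Q. linking E A B q" "pairwise (apart C) Q"
  obtains Q' where "card Q' = card Q" "\<forall>q \<in> Q'. tight_linking E A B q" "pairwise (apart C) Q'"
proof -
  have "\<forall>q \<in> Q. \<exists>q'. tight_linking E A B q' \<and> set q' \<subseteq> set q"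
    using assms(1) tight_linking_exists by metis
  then obtain g where g: "\<forall>q \<in> Q. tight_linking E A B (g q) \<and> set (g q) \<subseteq> set q"
    by metis
  have ap: "apart C (g q) (g r)" if "q \<in> Q" "r \<in> Q" "q \<noteq> r" for q r
  proof -
    have "apart C q r" using assms(2) that by (auto simp: pairwise_def)
    with g that show ?thesis unfolding apart_def by blast
  qed
  have "inj_on g Q"
  proof
    fix q r assume qr: "q \<in> Q" "r \<in> Q" "g q = g r"
    have "g q \<noteq> []" using g qr by (auto simp: tight_linking_def linking_def)
    then show "q = r" using ap[of q r] qr by (auto simp: apart_def)
  qed
  show thesis
  proof (rule that[of "g ` Q"])
    show "card (g ` Q) = card Q" by (rule card_image) fact
    show "\<forall>q \<in> g ` Q. tight_linking E A B q" using g by blast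
    show "pairwise (apart C) (g ` Q)" using ap by (auto simp: pairwise_def)
  qed
qed

lemma tight_linking_distinct:
  assumes "tight_linking E A B q"
  shows "distinct q"
proof (rule ccontr)
  assume "\<not> distinct q"
  then obtain xs ys zs a where q: "q = xs @ [a] @ ys @ [a] @ zs"
    using not_distinct_decomp by blast
  have "linking E A B q" using assms by (simp add: tight_linking_def)
  then have "linking E A B (xs @ a # zs)"
    using linking_append_Cons[of E A B xs a "ys @ [a] @ zs" A B "xs @ [a] @ ys" zs] q by simp
  moreover have "set (xs @ a # zs) \<subseteq> set q" using q by auto
  ultimately have "length q \<le> length (xs @ a # zs)"
    using assms unfolding tight_linking_def by blast
  then show False using q by simp
qed

lemma tight_linking_start:
  assumes "tight_linking E A B (xs @ v # ys)" "v \<in> A"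
  shows "xs = []"
proof -
  have "linking E A B (v # ys)"
    using assms unfolding tight_linking_def linking_def by (auto simp: successively_append_iff)
  then have "length (xs @ v # ys) \<le> length (v # ys)"
    using assms(1) unfolding tight_linking_def by auto
  then show ?thesis by simp
qed

lemma tight_linking_end:
  assumes "tight_linking E A B (xs @ v # ys)" "v \<in> B"
  shows "ys = []"
proof -
  have "linking E A B (xs @ [v])"
    using assms unfolding tight_linking_def linking_def
    by (auto simp: successively_append_iff hd_append)
  then have "length (xs @ v # ys) \<le> length (xs @ [v])"
    using assms(1) unfolding tight_linking_def by auto
  then show ?thesis by simp
qed

lemma tight_linking_induced:
  assumes "tight_linking E A B (xs @ u # ys @ v # zs)" "(u, v) \<in> E"
  shows "ys = []"
proof -
  have "linking E A B (xs @ u # v # zs)"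
    using assms unfolding tight_linking_def linking_def
    by (auto simp: successively_append_iff successively_Cons hd_append split: if_splits)
  then have "length (xs @ u # ys @ v # zs) \<le> length (xs @ u # v # zs)"
    using assms(1) unfolding tight_linking_def by auto
  then show ?thesis by simp
qed

text \<open>An arc to a vertex that is not next to \<open>v\<close> on the walk would be a shortcut;
  symmetry of \<open>E\<close> covers both sides of \<open>v\<close>.\<close>

lemma tight_linking_neighbour:
  assumes "tight_linking E A B (xs @ v # ys)" "sym E"
    and "w \<in> set (xs @ v # ys)" "w \<noteq> v" "(w, v) \<in> E"
  shows "xs \<noteq> [] \<and> w = last xs \<or> ys \<noteq> [] \<and> w = hd ys"
proof -
  consider "w \<in> set xs" | "w \<in> set ys" using assms by auto
  then show ?thesis
  proof cases
    case 1
    then obtain as bs where xs: "xs = as @ w # bs" by (meson split_list)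
    then have "bs = []" using tight_linking_induced[of E A B as w bs v ys] assms by simp
    then show ?thesis using xs by simp
  next
    case 2
    then obtain as bs where ys: "ys = as @ w # bs" by (meson split_list)
    have "(v, w) \<in> E" using assms by (meson symD)
    then have "as = []" using tight_linking_induced[of E A B xs v as w bs] assms ys by simp
    then show ?thesis using ys by simp
  qed
qed

section \<open>Menger's theorem\<close>

text \<open>Finiteness is part of the notion because an infinite set has \<open>card\<close>
  0.\<close>

definition separating :: "'a rel \<Rightarrow> 'a set \<Rightarrow> 'a set \<Rightarrow> 'a set \<Rightarrow> bool" where
  "separating E A B Z \<longleftrightarrow> finite Z \<and> (\<forall>p. linking E A B p \<longrightarrow> set p \<inter> Z \<noteq> {})"

text \<open>Traversing \<open>(x, y)\<close> needs \<open>x\<close> at a non-final and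
  \<open>y\<close> at a non-initial position.\<close>

lemma successively_insert_arc:
  assumes "successively (\<lambda>u v. (u, v) \<in> insert (x, y) E) p" "x \<notin> set (butlast p) \<or> y \<notin> set (tl p)"
  shows "successively (\<lambda>u v. (u, v) \<in> E) p"
  using assms
proof (induction p rule: induct_list012)
  case (3 a b zs)
  then show ?case by (auto split: if_splits)
qed auto

text \<open>A walk that uses the new arc meets both of its ends; any other walk already meets
  \<open>S\<close>.\<close>

lemma separating_insert_arc:
  assumes "separating E A B S"
  shows "separating (insert (x, y) E) A B (insert x S)" "separating (insert (x, y) E) A B (insert y S)"
proof -
  have "set p \<inter> insert x S \<noteq> {} \<and> set p \<inter> insert y S \<noteq> {}"
    if p: "linking (insert (x, y) E) A B p" for p
  proof (cases "x \<in> set (butlast p) \<and> y \<in> set (tl p)")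
    case True
    then show ?thesis by (auto dest: in_set_butlastD list.set_sel(2)[rotated] simp: linking_def)
  next
    case False
    then have "linking E A B p"
      using p successively_insert_arc unfolding linking_def by metis
    then show ?thesis using assms by (auto simp: separating_def)
  qed
  then show "separating (insert (x, y) E) A B (insert x S)"
    "separating (insert (x, y) E) A B (insert y S)"
    using assms by (auto simp: separating_def)
qed

text \<open>Cut a walk at its first vertex in \<open>S\<close>. As \<open>x\<close> lies in
  \<open>S\<close>, the initial segment can reach \<open>x\<close> only at its end, so it avoids the
  new arc and must meet \<open>T\<close>.\<close>

lemma separating_initial:
  assumes S: "separating (insert (x, y) E) A B S" "x \<in> S" and T: "separating E A S T"
  shows "separating (insert (x, y) E) A B T"
proof -
  have "set p \<inter> T \<noteq> {}" if p: "linking (insert (x, y) E) A B p" for p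
  proof -
    have "\<exists>s \<in> set p. s \<in> S" using S(1) p by (auto simp: separating_def)
    then obtain as s bs where ps: "p = as @ s # bs" "s \<in> S" "\<forall>a \<in> set as. a \<notin> S"
      by (auto dest!: split_list_first_prop)
    have "successively (\<lambda>u v. (u, v) \<in> insert (x, y) E) (as @ [s])"
      using p ps(1) by (auto simp: linking_def successively_append_iff)
    then have "successively (\<lambda>u v. (u, v) \<in> E) (as @ [s])"
      by (rule successively_insert_arc) (use ps S(2) in auto)
    then have "linking E A S (as @ [s])"
      using p ps by (auto simp: linking_def hd_append)
    then show ?thesis using T ps(1) by (fastforce simp: separating_def)
  qed
  then show ?thesis using T by (auto simp: separating_def)
qed

text \<open>The mirror image: cut at the last vertex in \<open>S\<close>, after which
  \<open>y\<close> cannot occur.\<close>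

lemma separating_final:
  assumes S: "separating (insert (x, y) E) A B S" "y \<in> S" and T: "separating E S B T"
  shows "separating (insert (x, y) E) A B T"
proof -
  have "set p \<inter> T \<noteq> {}" if p: "linking (insert (x, y) E) A B p" for p
  proof -
    have "\<exists>s \<in> set p. s \<in> S" using S(1) p by (auto simp: separating_def)
    then obtain as s bs where ps: "p = as @ s # bs" "s \<in> S" "\<forall>b \<in> set bs. b \<notin> S"
      by (auto dest!: split_list_last_prop)
    have "successively (\<lambda>u v. (u, v) \<in> insert (x, y) E) (s # bs)"
      using p ps(1) by (auto simp: linking_def successively_append_iff)
    then have "successively (\<lambda>u v. (u, v) \<in> E) (s # bs)"
      by (rule successively_insert_arc) (use ps S(2) in auto)
    then have "linking E S B (s # bs)"
      using p ps by (auto simp: linking_def)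
    then show ?thesis using T ps(1) by (fastforce simp: separating_def)
  qed
  then show ?thesis using T by (auto simp: separating_def)
qed

text \<open>Disjoint walks have different marked vertices, and an injection between finite sets of
  equal size is onto. This indexes the walks by their ends.\<close>

lemma apart_family_ends:
  assumes P: "\<forall>p \<in> P. linking E A B p" "pairwise (apart C) P" and card: "card P = card U" "finite U"
    and e: "\<And>p. p \<in> P \<Longrightarrow> e p \<in> set p \<and> e p \<in> U"
  obtains g where "\<And>t. t \<in> U \<Longrightarrow> g t \<in> P \<and> e (g t) = t"
proof -
  have "inj_on e P"
  proof
    fix p q assume "p \<in> P" "q \<in> P" "e p = e q"
    then show "p = q" using P(2) e[of p] e[of q] by (auto simp: pairwise_def apart_def)
  qed
  moreover have "e ` P \<subseteq> U" using e by blast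
  ultimately have "e ` P = U" using card by (simp add: card_image card_subset_eq)
  then have "\<forall>t \<in> U. \<exists>p. p \<in> P \<and> e p = t" by blast
  then show thesis using that by metis
qed

text \<open>Goering's proof: if deleting an arc \<open>(x, y)\<close> creates a smaller separator \<open>S\<close>, then the linkages
  from \<open>A\<close> to \<open>S \<union> {x}\<close> and from \<open>S \<union> {y}\<close> to \<open>B\<close> meet only in \<open>S\<close> and can be joined.\<close>

theorem menger:
  assumes "finite E" "finite A" "\<And>Z. separating E A B Z \<Longrightarrow> n \<le> card Z"
  shows "\<exists>P. card P = n \<and> (\<forall>p \<in> P. linking E A B p) \<and> pairwise (apart {}) P"
  using assms
proof (induction E arbitrary: A B rule: finite_induct)
  case empty
  \<comment> \<open>Without arcs every walk is a single vertex, so \<open>A \<inter> B\<close>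
    separates.\<close>
  have "p = [hd p]" if "linking {} A B p" for p
    using that by (cases p) (auto simp: linking_def successively_Cons)
  then have "separating {} A B (A \<inter> B)"
    using empty(1) unfolding separating_def linking_def
    by (metis IntI disjoint_iff finite_Int hd_in_set last.simps)
  then have "n \<le> card (A \<inter> B)" by (rule empty(2))
  then obtain U where U: "U \<subseteq> A \<inter> B" "card U = n" by (meson obtain_subset_with_card_n)
  show ?case
    by (rule exI[of _ "(\<lambda>u. [u]) ` U"])
      (use U in \<open>auto simp: card_image inj_on_def linking_def pairwise_def apart_def\<close>)
next
  case (insert xy E)
  obtain x y where xy: "xy = (x, y)" by fastforce
  show ?case
  proof (cases "\<forall>Z. separating E A B Z \<longrightarrow> n \<le> card Z")
    case True
    then obtain P where "card P = n" "\<forall>p \<in> P. linking E A B p" "pairwise (apart {}) P"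
      using insert.IH[OF insert.prems(1)] by blast
    then show ?thesis using linking_mono[of E A B _ "insert xy E" A B] by blast
  next
    case False
    then obtain S where S: "separating E A B S" "card S < n" by force
    have "finite S" using S(1) by (simp add: separating_def)
    note sepx = separating_insert_arc(1)[OF S(1), of x y, folded xy]
    note sepy = separating_insert_arc(2)[OF S(1), of x y, folded xy]
    \<comment> \<open>Adding either end of the arc to \<open>S\<close> yields a separator for the
      full relation, while \<open>S\<close> itself has fewer than \<open>n\<close> elements; hence
      \<open>S\<close> has exactly \<open>n - 1\<close> and contains neither end.\<close>
    have cx: "card (insert x S) = n" "x \<notin> S"
      using insert.prems(2)[OF sepx] S(2) \<open>finite S\<close> by (auto simp: card_insert_if split: if_splits)
    have cy: "card (insert y S) = n" "y \<notin> S"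
      using insert.prems(2)[OF sepy] S(2) \<open>finite S\<close> by (auto simp: card_insert_if split: if_splits)
    have "\<exists>P. card P = n \<and> (\<forall>p \<in> P. linking E A (insert x S) p) \<and> pairwise (apart {}) P"
      by (intro insert.IH insert.prems)
        (use separating_initial[OF sepx[unfolded xy]] xy in auto)
    then obtain P where P: "card P = n" "\<forall>p \<in> P. tight_linking E A (insert x S) p"
      "pairwise (apart {}) P"
      by (metis tight_linking_family)
    have "\<exists>P. card P = n \<and> (\<forall>p \<in> P. linking E (insert y S) B p) \<and> pairwise (apart {}) P"
      by (intro insert.IH insert.prems(2))
        (use separating_final[OF sepy[unfolded xy]] xy \<open>finite S\<close> in auto)
    then obtain Q where Q: "card Q = n" "\<forall>p \<in> Q. tight_linking E (insert y S) B p"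
      "pairwise (apart {}) Q"
      by (metis tight_linking_family)
    obtain f where f: "\<And>t. t \<in> insert x S \<Longrightarrow> f t \<in> P \<and> last (f t) = t"
      by (rule apart_family_ends[of P E A "insert x S" "{}" "insert x S" last])
        (use P cx \<open>finite S\<close> in \<open>auto simp: tight_linking_def linking_def\<close>)
    obtain g where g: "\<And>t. t \<in> insert y S \<Longrightarrow> g t \<in> Q \<and> hd (g t) = t"
      by (rule apart_family_ends[of Q E "insert y S" B "{}" "insert y S" hd])
        (use Q cy \<open>finite S\<close> in \<open>auto simp: tight_linking_def linking_def\<close>)
    have fl: "linking E A (insert x S) (f t)" "tight_linking E A (insert x S) (f t)" "f t \<noteq> []"
      if "t \<in> insert x S" for t
      using P(2) f[OF that] by (auto simp: tight_linking_def linking_def)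
    have gl: "linking E (insert y S) B (g t)" "tight_linking E (insert y S) B (g t)" "g t \<noteq> []"
      if "t \<in> insert y S" for t
      using Q(2) g[OF that] by (auto simp: tight_linking_def linking_def)
    \<comment> \<open>Switching walks at \<open>w\<close> gives a walk from \<open>A\<close> to
      \<open>B\<close> without the new arc, which must meet \<open>S\<close>. Tightness allows this
      only at the end of \<open>f t\<close> or the start of \<open>g t'\<close>, so the meeting
      point is \<open>w\<close>.\<close>
    have meet: "w = t \<and> w = t'"
      if t: "t \<in> insert x S" "t' \<in> insert y S" and w: "w \<in> set (f t)" "w \<in> set (g t')" for t t' w
    proof -
      obtain as bs where ft: "f t = as @ w # bs" using w(1) by (meson split_list)
      obtain cs ds where gt: "g t' = cs @ w # ds" using w(2) by (meson split_list)
      have "linking E A B (as @ w # ds)"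
        using linking_append_Cons fl(1)[OF t(1)] gl(1)[OF t(2)] ft gt by metis
      then obtain z where z: "z \<in> S" "z \<in> set (as @ w # ds)"
        using S(1) unfolding separating_def by blast
      have end1: "w = t" if "w \<in> S"
        using tight_linking_end[of E A "insert x S" as w bs] fl(2)[OF t(1)] f[OF t(1)] ft that
        by simp
      have end2: "w = t'" if "w \<in> S"
        using tight_linking_start[of E "insert y S" B cs w ds] gl(2)[OF t(2)] g[OF t(2)] gt that
        by simp
      have "w \<in> S"
      proof (rule ccontr)
        assume "w \<notin> S"
        with z consider "z \<in> set as" | "z \<in> set ds" by auto
        then show False
        proof cases
          case 1
          then obtain us vs where "as = us @ z # vs" by (meson split_list)
          then show False
            using tight_linking_end[of E A "insert x S" us z "vs @ w # bs"] fl(2)[OF t(1)] ft z(1)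
            by simp
        next
          case 2
          then obtain us vs where "ds = us @ z # vs" by (meson split_list)
          then show False
            using tight_linking_start[of E "insert y S" B "cs @ w # us" z vs] gl(2)[OF t(2)] gt z(1)
            by simp
        qed
      qed
      then show ?thesis using end1 end2 by blast
    qed
    \<comment> \<open>\<open>h\<close> pairs the end of a first walk with the start of a second: the
      identity on \<open>S\<close>, and \<open>x\<close> to \<open>y\<close> across the arc.\<close>
    define h where "h t = (if t = x then y else t)" for t
    have h: "h t \<in> insert y S" if "t \<in> insert x S" for t using that by (auto simp: h_def)
    have h_inj: "t = t'" if "t \<in> insert x S" "t' \<in> insert x S" "h t = h t'" for t t'
      using that cx cy by (auto simp: h_def split: if_splits)
    \<comment> \<open>If the two walks share \<open>t\<close>, it is listed once; otherwise the new
      arc bridges them. Testing \<open>h t = t\<close> also handles the case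
      \<open>x = y\<close>.\<close>
    define r where "r t = (if h t = t then f t @ tl (g t) else f t @ g (h t))" for t
    have r_set: "set (r t) \<subseteq> set (f t) \<union> set (g (h t))" if "t \<in> insert x S" for t
      using gl(3)[OF h[OF that]] by (auto simp: r_def dest: list.set_sel(2)[rotated])
    have r_link: "linking (insert xy E) A B (r t)" if t: "t \<in> insert x S" for t
    proof (cases "h t = t")
      case True
      note gt = gl(1)[OF h[OF t]] g[OF h[OF t]]
      obtain ds where ds: "g t = t # ds"
        using gt True by (cases "g t") (auto simp: linking_def)
      obtain as where as: "f t = as @ [t]"
        using fl(3)[OF t] f[OF t] by (metis append_butlast_last_id)
      have "linking E A B (as @ t # ds)"
        using linking_append_Cons[of E A "insert x S" as t "[]" "insert y S" B "[]" ds]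
          fl(1)[OF t] gt(1) True as ds by simp
      then have "linking E A B (r t)" using True as ds by (simp add: r_def)
      then show ?thesis by (rule linking_mono) auto
    next
      case False
      then have "t = x" "h t = y" by (auto simp: h_def split: if_splits)
      then show ?thesis
        using False fl(1)[OF t] gl(1)[OF h[OF t]] f[OF t] g[OF h[OF t]] xy
        unfolding r_def linking_def by (auto simp: successively_append_iff elim: successively_mono)
    qed
    have r_apart: "apart {} (r t) (r t')" if t: "t \<in> insert x S" "t' \<in> insert x S" "t \<noteq> t'" for t t'
    proof -
      have "f t \<noteq> f t'" using f t by metis
      then have ff: "set (f t) \<inter> set (f t') = {}"
        using f[OF t(1)] f[OF t(2)] P(3) unfolding pairwise_def apart_def by blast
      have "g (h t) \<noteq> g (h t')" using g h h_inj t by metis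
      then have gg: "set (g (h t)) \<inter> set (g (h t')) = {}"
        using g[OF h[OF t(1)]] g[OF h[OF t(2)]] Q(3) unfolding pairwise_def apart_def by blast
      have cross: "set (f s) \<inter> set (g (h s')) = {}"
        if s: "s \<in> insert x S" "s' \<in> insert x S" "s \<noteq> s'" for s s'
      proof (rule ccontr)
        assume "set (f s) \<inter> set (g (h s')) \<noteq> {}"
        then obtain w where "w \<in> set (f s)" "w \<in> set (g (h s'))" by blast
        then have "s = h s'" using meet[OF s(1) h[OF s(2)]] by blast
        then show False using s cx cy by (auto simp: h_def split: if_splits)
      qed
      show ?thesis
        using r_set[OF t(1)] r_set[OF t(2)] ff gg cross[OF t] cross[OF t(2,1)] t(3)
        unfolding apart_def by blast
    qed
    have "inj_on r (insert x S)"
    proof (rule inj_onI)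
      fix t t' assume t: "t \<in> insert x S" "t' \<in> insert x S" "r t = r t'"
      then show "t = t'" using r_apart[of t t'] r_link[of t] by (auto simp: apart_def linking_def)
    qed
    then have "card (r ` insert x S) = n" using cx card_image by metis
    moreover have "pairwise (apart {}) (r ` insert x S)"
      using r_apart unfolding pairwise_def by blast
    ultimately show ?thesis using r_link by (intro exI[of _ "r ` insert x S"]) blast
  qed
qed

section \<open>Making a family of walks non-adjacent in one colour\<close>

text \<open>On a tight walk \<open>v\<close> has at most two neighbours besides itself, and
  \<open>u\<close> is one of them. If \<open>v\<close> lies in \<open>A\<close> or \<open>B\<close>
  it is an end, so \<open>u\<close> is the only one; in both, the walk would be just
  \<open>v\<close>.\<close>

lemma tight_linking_last_neighbour:
  assumes q: "tight_linking E A B q" "sym E" "u \<in> set q" "v \<in> set q" "u \<noteq> v" "(u, v) \<in> E"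
  defines "N \<equiv> {w \<in> set q. (w, v) \<in> E \<and> w \<noteq> v \<and> w \<noteq> u}"
  shows "a \<in> N \<Longrightarrow> b \<in> N \<Longrightarrow> a = b" "v \<in> A \<union> B \<Longrightarrow> N = {}" "\<not> (v \<in> A \<and> v \<in> B)"
proof -
  obtain xs ys where xs: "q = xs @ v # ys" using q(4) by (meson split_list)
  note nb = tight_linking_neighbour[OF q(1)[unfolded xs] q(2), folded xs]
  have u: "xs \<noteq> [] \<and> u = last xs \<or> ys \<noteq> [] \<and> u = hd ys"
    using nb[of u] q by blast
  have N: "w \<noteq> u \<and> (xs \<noteq> [] \<and> w = last xs \<or> ys \<noteq> [] \<and> w = hd ys)" if "w \<in> N" for w
    using nb[of w] that unfolding N_def by blast
  have X: "xs = []" if "v \<in> A" using tight_linking_start q(1) xs that by metis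
  have Y: "ys = []" if "v \<in> B" using tight_linking_end q(1) xs that by metis
  show "a \<in> N \<Longrightarrow> b \<in> N \<Longrightarrow> a = b" using N[of a] N[of b] u by auto
  show "v \<in> A \<union> B \<Longrightarrow> N = {}" using X Y N u by auto
  show "\<not> (v \<in> A \<and> v \<in> B)" using X Y u by auto
qed

text \<open>The neighbours of \<open>v\<close> along \<open>r\<close> lie in \<open>N\<close>, which
  has at most one element, so \<open>v\<close> is an end of \<open>r\<close>. Then \<open>N\<close>
  is empty, \<open>r\<close> is just \<open>v\<close>, and \<open>v\<close> lies in both
  \<open>A\<close> and \<open>B\<close>, which was excluded.\<close>

lemma linking_avoiding_neighbour:
  assumes q: "tight_linking E A B q" "sym E" "u \<in> set q" "v \<in> set q" "(u, v) \<in> E"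
    and r: "linking H A B r" "distinct r" "v \<in> set r" "u \<notin> set r"
    and H: "sym H" "\<And>w. (w, v) \<in> H \<Longrightarrow> w \<in> set q \<and> (w, v) \<in> E"
  shows False
proof -
  define N where "N = {w \<in> set q. (w, v) \<in> E \<and> w \<noteq> v \<and> w \<noteq> u}"
  have "u \<noteq> v" using r by blast
  note t = tight_linking_last_neighbour[OF q(1-4) this q(5), folded N_def]
  obtain xs ys where xs: "r = xs @ v # ys" using r(3) by (meson split_list)
  have 1: "last xs \<in> N" if "xs \<noteq> []"
  proof -
    have "(last xs, v) \<in> H" using r(1) that unfolding xs linking_def
      by (auto simp: successively_append_iff)
    moreover have "last xs \<in> set xs" using that by simp
    ultimately show ?thesis using H(2)[of "last xs"] r(2,4) xs by (auto simp: N_def)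
  qed
  have 2: "hd ys \<in> N" if "ys \<noteq> []"
  proof -
    have "(v, hd ys) \<in> H" using r(1) that unfolding xs linking_def
      by (auto simp: successively_append_iff successively_Cons)
    then have "(hd ys, v) \<in> H" using H(1) by (meson symD)
    moreover have "hd ys \<in> set ys" using that by simp
    ultimately show ?thesis using H(2)[of "hd ys"] r(2,4) xs by (auto simp: N_def)
  qed
  have 3: "xs = [] \<or> ys = []"
  proof (rule ccontr)
    assume "\<not> (xs = [] \<or> ys = [])"
    then have "last xs = hd ys" "last xs \<in> set xs" "hd ys \<in> set ys" using t(1) 1 2 by auto
    then show False using r(2) xs by auto
  qed
  have "v \<in> A" if "xs = []" using r(1) that xs by (simp add: linking_def)
  moreover have "v \<in> B" if "ys = []" using r(1) that xs by (simp add: linking_def)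
  ultimately show False using 1 2 3 t(2,3) by blast
qed

text \<open>Vertices with equal image are equal or joined by \<open>H\<close>, so inside each
  contracted class at most one extra arc connects the entry vertex to the exit vertex. The start
  \<open>a\<close> varies in the induction.\<close>

lemma linking_lift:
  assumes sgl: "\<And>a b. a \<in> V \<Longrightarrow> b \<in> V \<Longrightarrow> f a = f b \<Longrightarrow> a = b \<or> (a, b) \<in> H" and "H \<subseteq> V \<times> V"
    and "successively (\<lambda>u v. (u, v) \<in> map_prod f f ` H) p" "p \<noteq> []"
    and "hd p = f a" "last p = f b" "a \<in> V" "b \<in> V"
  shows "\<exists>r. linking H {a} {b} r \<and> f ` set r \<subseteq> set p"
  using assms(3-)
proof (induction p arbitrary: a rule: induct_list012)
  case (2 z)
  then have "a = b \<or> (a, b) \<in> H" using sgl by auto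
  then show ?case
  proof
    assume "a = b"
    then show ?thesis using 2 by (intro exI[of _ "[a]"]) (auto simp: linking_def)
  next
    assume "(a, b) \<in> H"
    then show ?thesis using 2 by (intro exI[of _ "[a, b]"]) (auto simp: linking_def)
  qed
next
  case (3 z z' zs)
  then obtain u v where uv: "(u, v) \<in> H" "z = f u" "z' = f v" by auto
  then have V: "u \<in> V" "v \<in> V" using assms(2) by auto
  then obtain r where r: "linking H {v} {b} r" "f ` set r \<subseteq> set (z' # zs)"
    using "3.IH"(2)[of v] "3.prems" uv(3) by fastforce
  have "a = u \<or> (a, u) \<in> H" using sgl[of a u] 3 uv V by auto
  then show ?case
  proof
    assume "a = u"
    then show ?thesis using r uv by (intro exI[of _ "a # r"]) (auto simp: linking_def successively_Cons)
  next
    assume "(a, u) \<in> H"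
    then show ?thesis using r uv 3
      by (intro exI[of _ "a # u # r"]) (auto simp: linking_def successively_Cons)
  qed
qed simp

text \<open>Contracting the matching \<open>M\<close> in the graph formed by the given walks and the edges of \<open>M\<close>
  loses at most a factor two in connectivity. An edge \<open>uv\<close> of \<open>C\<close> joins no two of the new walks: it
  lies within one old walk, and as \<open>M\<close> is induced one of its ends, say \<open>v\<close>, meets no edge of \<open>M\<close>, so
  a walk through \<open>v\<close> has to follow the old walk in both directions and passes through \<open>u\<close>.\<close>

lemma apart_halving:
  assumes E: "finite E" "sym E"
    and C: "C \<subseteq> E" "sym C" "C \<inter> M = {}"
    and M: "M \<subseteq> E" "sym M" "single_valued M"
      "\<And>u u' v v'. (u, u') \<in> M \<Longrightarrow> (v, v') \<in> M \<Longrightarrow> (u, v) \<in> E \<Longrightarrow> (u, v) \<in> M"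
    and Q: "finite Q" "\<forall>q \<in> Q. linking E X Y q" "pairwise (apart C) Q"
  shows "\<exists>R. finite R \<and> card Q \<le> 2 * card R \<and> (\<forall>r \<in> R. linking E X Y r) \<and> pairwise (apart (C \<union> M)) R"
proof (cases "Q = {}")
  case True
  then show ?thesis by (intro exI[of _ "{}"]) auto
next
  case False
  obtain T where T: "card T = card Q" "\<forall>q \<in> T. tight_linking E X Y q" "pairwise (apart C) T"
    using tight_linking_family Q(2,3) by metis
  have "finite T" using T(1) Q(1) False by (metis card_eq_0_iff)
  define V where "V = (\<Union>q \<in> T. set q)"
  have "finite V" using \<open>finite T\<close> by (simp add: V_def)
  \<comment> \<open>By tightness, the arcs of \<open>E\<close> inside one old walk join only
    consecutive vertices, loops aside; different walks are linked only by \<open>M\<close>.\<close>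
  define H where "H = {(a, b). a \<in> V \<and> b \<in> V \<and> (a, b) \<in> E \<and>
    ((\<exists>q \<in> T. a \<in> set q \<and> b \<in> set q) \<or> (a, b) \<in> M)}"
  have "H \<subseteq> E" "H \<subseteq> V \<times> V" by (auto simp: H_def)
  have "sym H" using E(2) M(2) unfolding H_def sym_def by blast
  \<comment> \<open>The contraction of \<open>M\<close>: a vertex is represented by its class,
    itself together with its partner in \<open>V\<close> if there is one.\<close>
  define f where "f v = insert v (M `` {v} \<inter> V)" for v
  have M_eq: "w = v'" if "(v, w) \<in> M" "(v, v') \<in> M" for v w v'
    using M(3) that by (meson single_valuedD)
  have f_eq: "f a = f b \<longleftrightarrow> a = b \<or> (a, b) \<in> M" if "a \<in> V" "b \<in> V" for a b
    using that M(2) M_eq unfolding f_def sym_def by fast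
  let ?E = "map_prod f f ` H" and ?X = "f ` (X \<inter> V)" and ?Y = "f ` (Y \<inter> V)"
  have link: "linking ?E ?X ?Y (map f q)" if q: "q \<in> T" for q
  proof -
    have lq: "linking E X Y q" using T(2) q by (auto simp: tight_linking_def)
    then have "successively (\<lambda>u v. (u, v) \<in> E) q" by (simp add: linking_def)
    then have "successively (\<lambda>u v. (u, v) \<in> H) q"
      by (rule successively_mono) (use q in \<open>auto simp: H_def V_def\<close>)
    then have "successively (\<lambda>u v. (u, v) \<in> ?E) (map f q)"
      unfolding successively_map by (rule successively_mono) auto
    moreover have "hd q \<in> V" "last q \<in> V"
      using q lq hd_in_set[of q] last_in_set[of q] unfolding V_def linking_def by blast+
    ultimately show ?thesis using lq by (auto simp: linking_def hd_map last_map)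
  qed
  \<comment> \<open>Half of \<open>card Q\<close>, rounded up, so that
    \<open>card Q \<le> 2 * n\<close>.\<close>
  define n where "n = (card Q + 1) div 2"
  \<comment> \<open>The preimage of \<open>Z\<close> meets each of the disjoint walks in
    \<open>T\<close>, and each contracted vertex accounts for at most two vertices.\<close>
  have sep: "n \<le> card Z" if Z: "separating ?E ?X ?Y Z" for Z
  proof -
    have "\<forall>q \<in> T. \<exists>v. v \<in> set q \<and> f v \<in> Z"
      using link Z unfolding separating_def by fastforce
    then obtain g where g: "\<forall>q \<in> T. g q \<in> set q \<and> f (g q) \<in> Z" by metis
    have "inj_on g T"
    proof
      fix p q assume "p \<in> T" "q \<in> T" "g p = g q"
      then show "p = q" using T(3) g unfolding pairwise_def apart_def by (metis disjoint_iff)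
    qed
    then have "card T \<le> card {v \<in> V. f v \<in> Z}"
    proof (rule card_inj_on_le)
      show "g ` T \<subseteq> {v \<in> V. f v \<in> Z}" using g by (auto simp: V_def)
    qed (use \<open>finite V\<close> in simp)
    also have "{v \<in> V. f v \<in> Z} = (\<Union>z \<in> Z. {v \<in> V. f v = z})" by auto
    also have "card \<dots> \<le> (\<Sum>z \<in> Z. card {v \<in> V. f v = z})"
      using Z by (intro card_UN_le) (simp add: separating_def)
    also have "\<dots> \<le> (\<Sum>z \<in> Z. 2)"
    proof (rule sum_mono)
      fix z
      show "card {v \<in> V. f v = z} \<le> 2"
      proof (cases "{v \<in> V. f v = z} = {}")
        case False
        then obtain a where a: "a \<in> V" "f a = z" by blast
        obtain b where b: "M `` {a} \<subseteq> {b}" using M_eq by blast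
        have "v = a \<or> v = b" if "v \<in> V" "f v = z" for v
          using f_eq[OF a(1) that(1)] a(2) that(2) b by blast
        then have "{v \<in> V. f v = z} \<subseteq> {a, b}" by blast
        then have "card {v \<in> V. f v = z} \<le> card {a, b}" by (intro card_mono) auto
        also have "\<dots> \<le> 2" by (simp add: card_insert_if)
        finally show ?thesis .
      qed (simp only: card.empty)
    qed
    finally show ?thesis using T(1) by (simp add: n_def)
  qed
  have "finite H" using \<open>H \<subseteq> E\<close> E(1) finite_subset by blast
  then have "\<exists>P. card P = n \<and> (\<forall>p \<in> P. linking ?E ?X ?Y p) \<and> pairwise (apart {}) P"
    by (intro menger sep) (use \<open>finite V\<close> in auto)
  then obtain P where P: "card P = n" "\<forall>p \<in> P. linking ?E ?X ?Y p" "pairwise (apart {}) P"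
    by blast
  have "n > 0" using False Q(1) by (simp add: n_def card_gt_0_iff Suc_leI)
  then have "finite P" using P(1) by (metis card.infinite less_irrefl)
  have "\<exists>r. linking H (X \<inter> V) (Y \<inter> V) r \<and> distinct r \<and> f ` set r \<subseteq> set p" if "p \<in> P" for p
  proof -
    have p: "linking ?E ?X ?Y p" using P(2) that by blast
    then obtain a b where ab: "hd p = f a" "last p = f b" "a \<in> X \<inter> V" "b \<in> Y \<inter> V"
      by (auto simp: linking_def)
    have "\<exists>r. linking H {a} {b} r \<and> f ` set r \<subseteq> set p"
    proof (rule linking_lift[of V])
      show "a' = b' \<or> (a', b') \<in> H" if "a' \<in> V" "b' \<in> V" "f a' = f b'" for a' b'
        using f_eq[OF that(1,2)] that M(1) by (auto simp: H_def)
    qed (use p ab \<open>H \<subseteq> V \<times> V\<close> in \<open>auto simp: linking_def\<close>)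
    then obtain r where r: "linking H {a} {b} r" "f ` set r \<subseteq> set p" by blast
    \<comment> \<open>Lifting may repeat vertices; a shortest walk inside the lift is distinct and
      keeps both ends.\<close>
    obtain r' where r': "tight_linking H {a} {b} r'" "set r' \<subseteq> set r"
      using tight_linking_exists[OF r(1)] .
    have "linking H (X \<inter> V) (Y \<inter> V) r'"
      using r'(1) linking_mono[of H "{a}" "{b}" r' H] ab by (auto simp: tight_linking_def)
    then show ?thesis using r r' tight_linking_distinct[OF r'(1)] by blast
  qed
  then obtain g where g: "\<And>p. p \<in> P \<Longrightarrow> linking H (X \<inter> V) (Y \<inter> V) (g p)"
    "\<And>p. p \<in> P \<Longrightarrow> distinct (g p)" "\<And>p. p \<in> P \<Longrightarrow> f ` set (g p) \<subseteq> set p"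
    by metis
  have gV: "set (g p) \<subseteq> V" if "p \<in> P" for p
    using linking_verts[OF g(1)[OF that]] \<open>H \<subseteq> V \<times> V\<close> by blast
  have gXY: "linking H X Y (g p)" if "p \<in> P" for p
    using linking_mono[OF g(1)[OF that]] by blast
  \<comment> \<open>Disjointness after contraction rules out both a common vertex and an edge of
    \<open>M\<close> between two lifted walks.\<close>
  have f_ne: "f u \<noteq> f v" if "p \<in> P" "p' \<in> P" "p \<noteq> p'" "u \<in> set (g p)" "v \<in> set (g p')" for p p' u v
    using that g(3)[of p] g(3)[of p'] P(3) unfolding pairwise_def apart_def by blast
  have no_C: "\<exists>w. (v, w) \<in> M"
    if p: "p' \<in> P" "v \<in> set (g p')" "u \<notin> set (g p')" and uv: "(u, v) \<in> C" "u \<in> V" for p' u v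
  proof (rule ccontr)
    assume nM: "\<nexists>w. (v, w) \<in> M"
    have "v \<in> V" using gV p by blast
    then obtain q q' where q: "q \<in> T" "q' \<in> T" "u \<in> set q" "v \<in> set q'"
      using uv(2) by (auto simp: V_def)
    then have "q = q'" using T(3) uv(1) unfolding pairwise_def apart_def by blast
    show False
    proof (rule linking_avoiding_neighbour[of E X Y q u v H "g p'"])
      fix w assume w: "(w, v) \<in> H"
      then have "(w, v) \<notin> M" using nM M(2) by (meson symD)
      \<comment> \<open>Since \<open>M\<close> misses \<open>v\<close>, every arc of
        \<open>H\<close> at \<open>v\<close> stays inside an old walk, and only \<open>q\<close>
        contains \<open>v\<close>.\<close>
      then obtain q'' where q'': "q'' \<in> T" "w \<in> set q''" "v \<in> set q''" "(w, v) \<in> E"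
        using w by (auto simp: H_def)
      then have "q'' = q" using T(3) q \<open>q = q'\<close> unfolding pairwise_def apart_def by blast
      then show "w \<in> set q \<and> (w, v) \<in> E" using q'' by blast
    qed (use q \<open>q = q'\<close> T(2) E(2) uv(1) C(1) p gXY g(2) \<open>sym H\<close> in auto)
  qed
  have ap: "apart (C \<union> M) (g p) (g p')" if p: "p \<in> P" "p' \<in> P" "p \<noteq> p'" for p p'
    unfolding apart_def
  proof (intro conjI ballI)
    show disj: "set (g p) \<inter> set (g p') = {}" using f_ne[OF p] by blast
    fix u v assume u: "u \<in> set (g p)" and v: "v \<in> set (g p')"
    have V: "u \<in> V" "v \<in> V" using u v gV p by blast+
    have nM: "(u, v) \<notin> M" using f_ne[OF p u v] f_eq[OF V] by blast
    have "(u, v) \<notin> C"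
    proof
      assume uv: "(u, v) \<in> C"
      then have vu: "(v, u) \<in> C" using C(2) by (meson symD)
      \<comment> \<open>Both ends of the arc are now covered by \<open>M\<close>, so inducedness
        would put the arc itself into \<open>M\<close>.\<close>
      obtain w w' where "(u, w) \<in> M" "(v, w') \<in> M"
        using no_C[OF p(1) u _ vu V(2)] no_C[OF p(2) v _ uv V(1)] disj u v by blast
      then show False using M(4) uv C(1) nM by blast
    qed
    then show "(u, v) \<notin> C \<union> M" using nM by blast
  qed
  have "inj_on g P"
  proof
    fix p p' assume "p \<in> P" "p' \<in> P" "g p = g p'"
    then show "p = p'" using ap[of p p'] gXY[of p] by (auto simp: apart_def linking_def)
  qed
  then have "card (g ` P) = n" using P(1) card_image by metis
  moreover have "linking E X Y (g p)" if "p \<in> P" for p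
    using linking_mono[OF gXY[OF that] \<open>H \<subseteq> E\<close>] by blast
  moreover have "pairwise (apart (C \<union> M)) (g ` P)" using ap unfolding pairwise_def by blast
  moreover have "card Q \<le> 2 * n" by (simp add: n_def)
  ultimately show ?thesis using \<open>finite P\<close> by (intro exI[of _ "g ` P"]) auto
qed

section \<open>Strong edge colourings\<close>

text \<open>Giving each edge its own colour shows that the minimum is taken over a non-empty
  set.\<close>

lemma strong_edge_colouring_optimal:
  obtains \<M> where "strong_edge_colouring G \<M>" "card \<M> = strong_chromatic_index G"
proof -
  have "strong_edge_colouring G ((\<lambda>e. {e}) ` uedges G)"
    by (auto simp: strong_edge_colouring_def induced_matching_def partition_on_singletons)
  then have "\<exists>\<M>. strong_edge_colouring G \<M> \<and> card \<M> = card ((\<lambda>e. {e}) ` uedges G)" by blast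
  then have "\<exists>\<M>. strong_edge_colouring G \<M> \<and> card \<M> = strong_chromatic_index G"
    unfolding strong_chromatic_index_def by (rule LeastI)
  then show thesis using that by blast
qed

section \<open>Translation between the graph and relations on its vertices\<close>

lemma vwalk_arcs_subset_iff_successively:
  "set (vwalk_arcs p) \<subseteq> E \<longleftrightarrow> successively (\<lambda>u v. (u, v) \<in> E) p"
  by (induction p rule: vwalk_arcs.induct) auto

definition pairs_of :: "'a set set \<Rightarrow> 'a rel" where
  "pairs_of M = {(u, v). {u, v} \<in> M}"

context graph
begin

lemma uedges_iff: "{u, v} \<in> uedges G \<longleftrightarrow> (u, v) \<in> arcs_ends G"
  using sym_arcs unfolding uedges_def symmetric_def sym_def
  by (auto simp: doubleton_eq_iff)

lemma finite_uedges: "finite (uedges G)"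
proof -
  have "uedges G = (\<lambda>(u, v). {u, v}) ` arcs_ends G" unfolding uedges_def by auto
  then show ?thesis by (simp add: arcs_ends_def)
qed

lemma arcs_ends_verts: "arcs_ends G \<subseteq> verts G \<times> verts G"
  by (auto simp: arcs_ends_conv)

lemma arcs_ends_irrefl: "(u, u) \<notin> arcs_ends G"
  using no_loops by (auto simp: arcs_ends_conv)

lemma XY_path_of_linking:
  assumes "X \<subseteq> verts G" "distinct p" "linking (arcs_ends G) X Y p"
  shows "XY_path G X Y p"
  using assms linking_verts[OF assms(3) arcs_ends_verts assms(1)]
  by (auto simp: XY_path_def vpath_def vwalk_def linking_def vwalk_arcs_subset_iff_successively)

text \<open>An \<open>XY_path\<close> may run from \<open>Y\<close> to \<open>X\<close>; symmetry of
  the arcs permits reversing it, and separation depends only on the vertex set.\<close>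

lemma linking_of_XY_path:
  assumes "XY_path G X Y p"
  obtains q where "linking (arcs_ends G) X Y q" "set q = set p"
proof -
  have p: "successively (\<lambda>u v. (u, v) \<in> arcs_ends G) p" "p \<noteq> []"
    using assms by (auto simp: XY_path_def vpath_def vwalk_def vwalk_arcs_subset_iff_successively)
  then have "successively (\<lambda>u v. (u, v) \<in> arcs_ends G) (rev p)"
    using sym_arcs unfolding symmetric_def
    by (auto elim!: successively_mono dest: symD)
  with p have "linking (arcs_ends G) X Y p \<or> linking (arcs_ends G) X Y (rev p)"
    using assms by (auto simp: XY_path_def linking_def hd_rev last_rev)
  then show thesis using that[of p] that[of "rev p"] by auto
qed

text \<open>Everything follows from one fact, \<open>eq\<close>: two edges of \<open>M\<close> that
  share a vertex or are joined by an edge coincide. The conclusions are hypotheses of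
  \<open>apart_halving\<close>.\<close>

lemma pairs_of_induced_matching:
  assumes "induced_matching G M"
  shows "pairs_of M \<subseteq> arcs_ends G" "single_valued (pairs_of M)"
    "(u, u') \<in> pairs_of M \<Longrightarrow> (v, v') \<in> pairs_of M \<Longrightarrow> (u, v) \<in> arcs_ends G \<Longrightarrow> (u, v) \<in> pairs_of M"
proof -
  show sub: "pairs_of M \<subseteq> arcs_ends G"
    using assms uedges_iff by (auto simp: pairs_of_def induced_matching_def)
  have eq: "e = f" if "e \<in> M" "f \<in> M" "u \<in> e" "v \<in> f" "u = v \<or> (u, v) \<in> arcs_ends G" for e f u v
  proof (rule ccontr)
    assume "e \<noteq> f"
    then have "e \<inter> f = {}" "{u, v} \<notin> uedges G"
      using assms that(1-4) by (auto simp: induced_matching_def)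
    then show False using that(3-5) uedges_iff by blast
  qed
  show "single_valued (pairs_of M)"
  proof (rule single_valuedI)
    fix u v w assume "(u, v) \<in> pairs_of M" "(u, w) \<in> pairs_of M"
    then have "{u, v} = {u, w}" using eq[of "{u, v}" "{u, w}" u u] by (simp add: pairs_of_def)
    then show "v = w" by (auto simp: doubleton_eq_iff)
  qed
  assume uv: "(u, u') \<in> pairs_of M" "(v, v') \<in> pairs_of M" "(u, v) \<in> arcs_ends G"
  then have "{u, u'} = {v, v'}" using eq[of "{u, u'}" "{v, v'}" u v] by (auto simp: pairs_of_def)
  moreover have "u \<noteq> v" using uv(3) arcs_ends_irrefl by blast
  ultimately show "(u, v) \<in> pairs_of M" using uv(1) by (auto simp: doubleton_eq_iff)
qed

text \<open>Induction on the colour classes; each application of \<open>apart_halving\<close> costs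
  one factor of two.\<close>

lemma apart_family_colours:
  assumes "finite \<N>" "disjoint \<N>" "\<And>M. M \<in> \<N> \<Longrightarrow> induced_matching G M"
    and "finite Q" "\<forall>q \<in> Q. linking (arcs_ends G) X Y q" "pairwise (apart {}) Q"
  shows "\<exists>R. finite R \<and> card Q \<le> 2 ^ card \<N> * card R \<and>
    (\<forall>r \<in> R. linking (arcs_ends G) X Y r) \<and> pairwise (apart (pairs_of (\<Union>\<N>))) R"
  using assms(1-3)
proof (induction \<N> rule: finite_induct)
  case empty
  then show ?case using assms(4-) by (intro exI[of _ Q]) (auto simp: pairs_of_def)
next
  case (insert M \<N>)
  then obtain R where R: "finite R" "card Q \<le> 2 ^ card \<N> * card R"
    "\<forall>r \<in> R. linking (arcs_ends G) X Y r" "pairwise (apart (pairs_of (\<Union>\<N>))) R"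
    by (auto simp: pairwise_insert)
  note M = pairs_of_induced_matching[OF insert.prems(2)[OF insertI1]]
  have symp: "sym (pairs_of N)" for N :: "'a set set"
    by (auto simp: sym_def pairs_of_def insert_commute)
  have "\<exists>R'. finite R' \<and> card R \<le> 2 * card R' \<and> (\<forall>r \<in> R'. linking (arcs_ends G) X Y r) \<and>
    pairwise (apart (pairs_of (\<Union>\<N>) \<union> pairs_of M)) R'"
  proof (rule apart_halving)
    show "finite (arcs_ends G)" by (simp add: arcs_ends_def)
    show "sym (arcs_ends G)" using sym_arcs by (simp add: symmetric_def)
    show "pairs_of (\<Union>\<N>) \<subseteq> arcs_ends G"
    proof -
      have "pairs_of N \<subseteq> arcs_ends G" if "N \<in> \<N>" for N
        using pairs_of_induced_matching(1) insert.prems(2) that by blast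
      then show ?thesis unfolding pairs_of_def by blast
    qed
    have "M \<inter> N = {}" if "N \<in> \<N>" for N
      using insert.prems(1) insert.hyps(2) that by (auto simp: pairwise_insert disjnt_def)
    then show "pairs_of (\<Union>\<N>) \<inter> pairs_of M = {}" by (auto simp: pairs_of_def)
  qed (rule M symp R; assumption)+
  then obtain R' where R': "finite R'" "card R \<le> 2 * card R'"
    "\<forall>r \<in> R'. linking (arcs_ends G) X Y r"
    "pairwise (apart (pairs_of (\<Union>\<N>) \<union> pairs_of M)) R'" by blast
  note R(2)
  also have "2 ^ card \<N> * card R \<le> 2 ^ card \<N> * (2 * card R')"
    using R'(2) by (rule mult_le_mono2)
  also have "\<dots> = 2 ^ card (insert M \<N>) * card R'" using insert.hyps by simp
  finally have "card Q \<le> 2 ^ card (insert M \<N>) * card R'" .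
  moreover have "pairs_of (\<Union>(insert M \<N>)) = pairs_of (\<Union>\<N>) \<union> pairs_of M"
    by (auto simp: pairs_of_def)
  ultimately show ?case using R' by metis
qed

end

theorem theorem1p5:
  fixes G :: "('a, 'b) pre_digraph" and X Y :: "'a set" and k :: nat
  assumes "graph G" and "X \<subseteq> verts G" and "Y \<subseteq> verts G" and "k > 0"
  shows "(\<exists>P. card P = k \<and> (\<forall>p \<in> P. XY_path G X Y p) \<and> pairwise (nonadjacent G) P) \<or>
         (\<exists>Z. separates G Z X Y \<and> card Z < 2 ^ strong_chromatic_index G * k)"
proof (rule disjCI)
  interpret graph G by fact
  let ?E = "arcs_ends G" and ?n = "2 ^ strong_chromatic_index G * k"
  assume none: "\<nexists>Z. separates G Z X Y \<and> card Z < ?n"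
  \<comment> \<open>A set \<open>separating\<close> the relation may contain points outside the
    graph; its trace on \<open>verts G\<close> is an honest separator and no larger.\<close>
  have "?n \<le> card Z" if Z: "separating ?E X Y Z" for Z
  proof -
    have "set p \<inter> (Z \<inter> verts G) \<noteq> {}" if p: "XY_path G X Y p" for p
    proof -
      obtain q where "linking ?E X Y q" "set q = set p" using linking_of_XY_path[OF p] .
      then have "set p \<inter> Z \<noteq> {}" using Z by (auto simp: separating_def)
      moreover have "set p \<subseteq> verts G" using p by (auto simp: XY_path_def)
      ultimately show ?thesis by blast
    qed
    then have "separates G (Z \<inter> verts G) X Y" by (simp add: separates_def)
    then have "?n \<le> card (Z \<inter> verts G)" using none by (meson not_le)
    also have "\<dots> \<le> card Z" using Z by (intro card_mono) (auto simp: separating_def)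
    finally show ?thesis .
  qed
  moreover have "finite ?E" "finite X"
    using finite_subset[OF assms(2)] by (simp_all add: arcs_ends_def)
  ultimately obtain Q where Q: "card Q = ?n" "\<forall>q \<in> Q. linking ?E X Y q" "pairwise (apart {}) Q"
    using menger by metis
  \<comment> \<open>Positive cardinality is what makes \<open>Q\<close> finite, since infinite sets
    have \<open>card\<close> 0.\<close>
  have "?n > 0" using assms(4) by simp
  then have "finite Q" using Q(1) by (metis card.infinite less_irrefl)
  obtain \<M> where \<M>: "strong_edge_colouring G \<M>" "card \<M> = strong_chromatic_index G"
    by (rule strong_edge_colouring_optimal)
  then have part: "partition_on (uedges G) \<M>" and ind: "\<And>M. M \<in> \<M> \<Longrightarrow> induced_matching G M"
    by (auto simp: strong_edge_colouring_def)
  have U: "\<Union>\<M> = uedges G" "disjoint \<M>" using part by (auto simp: partition_on_def)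
  have "finite \<M>" using finite_elements[OF finite_uedges part] .
  then obtain R where R: "card Q \<le> 2 ^ card \<M> * card R"
    "\<forall>r \<in> R. linking ?E X Y r" "pairwise (apart (pairs_of (uedges G))) R"
    using apart_family_colours[OF _ U(2) ind \<open>finite Q\<close> Q(2,3)] U(1) by metis
  \<comment> \<open>The walks in \<open>R\<close> may repeat vertices; tightening turns them into
    paths and keeps them apart.\<close>
  obtain S where S: "card S = card R" "\<forall>r \<in> S. tight_linking ?E X Y r"
    "pairwise (apart (pairs_of (uedges G))) S"
    using tight_linking_family R(2,3) by metis
  have "k \<le> card S" using R(1) Q(1) \<M>(2) S(1) by simp
  then obtain P where P: "P \<subseteq> S" "card P = k" by (meson obtain_subset_with_card_n)
  have "XY_path G X Y p" if "p \<in> P" for p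
    using that P(1) S(2) XY_path_of_linking[OF assms(2)] tight_linking_distinct
    unfolding tight_linking_def by (metis subsetD)
  moreover have "pairwise (nonadjacent G) P"
    using pairwise_subset[OF S(3) P(1)]
    by (auto simp: pairwise_def nonadjacent_def apart_def pairs_of_def)
  ultimately show "\<exists>P. card P = k \<and> (\<forall>p \<in> P. XY_path G X Y p) \<and> pairwise (nonadjacent G) P"
    using P(2) by blast
qed

end
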